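(* Let $(\mathbf{x},\mathbf{y},B,\mathbf{Z})$ be a generalized seed over a semifield $\mathbb{P}$, with $d_i=\deg Z_i$ and $D=(d_i\delta_{ij})$, placed at the initial vertex $t_0$ of $\mathbb{T}_n$. Let $F^t_j(\mathbf{y},\mathbf{z})$ be its $F$-polynomials, and let ${}^RF^t_j$ be the $F$-polynomials of its right-companion cluster algebra, i.e. of the ordinary cluster pattern with initial exchange matrix $BD$ (initial seed $(\mathbf{x},\mathbf{y}^{\mathbf{d}},BD)$, $\mathbf{y}^{\mathbf{d}}=(y_1^{d_1},\dots,y_n^{d_n})$). Let $F^t_j(\mathbf{y},\boldsymbol{0})$ denote the $F$-polynomial with $z_{i,s}$ set to $0$ for all $1\le i\le n$, $0<s<d_i$ (while $z_{i,0}=z_{i,d_i}=1$). Then for any $t\in\mathbb{T}_n$ and any $1\le j\le n$ the following equalities hold in $\mathbb{Q}_{\mathrm{sf}}(\mathbf{y})$ and $\mathbb{Q}_{\mathrm{sf}}(\mathbf{x},\mathbf{y})$ respectively (with $\mathbf{x},\mathbf{y}$ regarded as indeterminates): $$F^t_j(\mathbf{y},\boldsymbol{0})={}^RF^t_j\big({}^R\mathbf{y}\big)\qquad\text{and}\qquad F^t_j(\hat{\mathbf{y}},\boldsymbol{0})={}^RF^t_j\big({}^R\hat{\mathbf{y}}\big),$$ where ${}^Ry_i=y_i^{d_i}$, $\hat y_i=y_i\prod_{\ell=1}^n x_\ell^{b_{\ell i}}$ and ${}^R\hat y_i=\hat y_i^{d_i}$.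
   Context: Semifields. A semifield is a multiplicative abelian group $\mathbb{P}$ with an associative, commutative operation $\oplus$ over which multiplication distributes. $\mathbb{P}$ is torsion-free, $\mathbb{ZP}$ is its group ring (a domain), $\mathbb{QP}$ its field of fractions. $\mathbb{Q}_{\mathrm{sf}}(u_1,\dots,u_m)$ is the universal semifield of rational functions in $u_1,\dots,u_m$ that can be written in subtraction-free form (usual operations). $\mathrm{Trop}(u_1,\dots,u_m)$ is the free abelian multiplicative group on the $u_j$ with $\prod u_j^{a_j}\oplus\prod u_j^{b_j}=\prod u_j^{\min(a_j,b_j)}$. Write $[b]_+=\max(b,0)$. Generalized seeds. A generalized seed $(\mathbf{x},\mathbf{y},B,\mathbf{Z})$ over $\mathbb{P}$ consists of: algebraically independent elements $\mathbf{x}=(x_1,\dots,x_n)$ (cluster variables) of a degree-$n$ purely transcendental extension $\mathcal{F}$ of $\mathbb{QP}$ (identified with $\mathbb{QP}(\mathbf{x})$); $\mathbf{y}=(y_1,\dots,y_n)\in\mathbb{P}^n$ (coefficients); a skew-symmetrizable integer $n\times n$ matrix $B=(b_{ij})$; and polynomials $\mathbf{Z}=(Z_1,\dots,Z_n)$, $Z_i(u)=\sum_{s=0}^{d_i}z_{i,s}u^s$ with $d_i\ge1$, $z_{i,s}\in\mathbb{P}$, $z_{i,0}=z_{i,d_i}=1$. Put $\mathbf{z}=(z_{i,s})$ and $Z_i|_{\mathbb{P}}(y)=\bigoplus_{s=0}^{d_i}z_{i,s}y^s$ for $y\in\mathbb{P}$. Mutation. $\mu_k(\mathbf{x},\mathbf{y},B,\mathbf{Z})=(\mathbf{x}',\mathbf{y}',B',\mathbf{Z}')$,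 where $x_i'=x_i$ for $i\ne k$ and $x_k'x_k=\big(\prod_i x_i^{[-b_{ik}]_+}\big)^{d_k}\frac{Z_k(\hat y_k)}{Z_k|_{\mathbb{P}}(y_k)}$ with $\hat y_k=y_k\prod_i x_i^{b_{ik}}$; $y_k'=y_k^{-1}$ and $y_j'=y_j(y_k^{d_k})^{[b_{kj}]_+}Z_k|_{\mathbb{P}}(y_k)^{-b_{kj}}$ for $j\ne k$; $b'_{ij}=-b_{ij}$ if $i=k$ or $j=k$, and $b'_{ij}=b_{ij}+[b_{ik}]_+d_kb_{kj}+b_{ik}d_k[-b_{kj}]_+$ otherwise; $Z_i'=Z_i$ for $i\neq k$ and $Z_k'(u)=u^{d_k}Z_k(u^{-1})$. Patterns. $\mathbb{T}_n$ is the $n$-regular tree with edges labeled by $1,\dots,n$ so that the edges at each vertex have distinct labels. A generalized cluster pattern assigns to each $t\in\mathbb{T}_n$ a generalized seed $(\mathbf{x}^t,\mathbf{y}^t,B^t,\mathbf{Z}^t)$ so that seeds at the ends of an edge labeled $k$ are related by $\mu_k$; it is determined by the seed at the initial vertex $t_0$ (for which the superscript is dropped). An ordinary seed $(\mathbf{x},\mathbf{y},B)$ and its ordinary cluster pattern are the special case $Z_i(u)=1+u$ for all $i$ (so all $d_i=1$, and there are no variables $z_{i,s}$ with $0<s<d_i$). $F$-polynomials. Regard $x_i$, $y_i$ and $z_{i,s}$ ($0<s<d_i$) as independent indeterminates. $X$-functions $X^t_i\in\mathbb{Q}(\mathbf{x},\mathbf{y},\mathbf{z})$ are the cluster variables obtained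 by taking $\mathbb{P}=\mathrm{Trop}(\mathbf{y},\mathbf{z})$; one has $X_i^t\in\mathbb{Z}[\mathbf{x}^{\pm1},\mathbf{y},\mathbf{z}]$. The $F$-polynomials are $F^t_j(\mathbf{y},\mathbf{z})=X^t_j|_{x_1=\cdots=x_n=1}\in\mathbb{Z}[\mathbf{y},\mathbf{z}]$ (in the ordinary case, polynomials in $\mathbf{y}$ only); they admit subtraction-free expressions and depend, as polynomials, only on the initial matrix $B$ and the degrees $d_i$. ${}^RF^t_j({}^R\mathbf{y})$ means the polynomial ${}^RF^t_j$ evaluated at its $n$ arguments ${}^Ry_1,\dots,{}^Ry_n$. *)

theory Defs
  imports
    "HOL-Algebra.Group"
    "HOL-Library.Poly_Mapping"
    "HOL-Library.Nat_Bijection"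
    "HOL-Computational_Algebra.Fraction_Field"
begin

text \<open>All families are indexed by the natural numbers \<open>1, \<dots>, n\<close>; values at other indices play no role.\<close>

section \<open>Semifields and the field of fractions of their group rings\<close>

record 'p semifield = "'p monoid" +
  sadd :: "'p \<Rightarrow> 'p \<Rightarrow> 'p"

locale semifield = comm_group P for P :: "('p, 'm) semifield_scheme" (structure) +
  assumes sadd_closed: "\<lbrakk>a \<in> carrier P; b \<in> carrier P\<rbrakk> \<Longrightarrow> sadd P a b \<in> carrier P"
    and sadd_assoc: "\<lbrakk>a \<in> carrier P; b \<in> carrier P; c \<in> carrier P\<rbrakk>
      \<Longrightarrow> sadd P (sadd P a b) c = sadd P a (sadd P b c)"
    and sadd_comm: "\<lbrakk>a \<in> carrier P; b \<in> carrier P\<rbrakk> \<Longrightarrow> sadd P a b = sadd P b a"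
    and distrib: "\<lbrakk>a \<in> carrier P; b \<in> carrier P; c \<in> carrier P\<rbrakk>
      \<Longrightarrow> a \<otimes> sadd P b c = sadd P (a \<otimes> b) (a \<otimes> c)"

text \<open>\<open>sadd_upto P f m\<close> is \<open>f 0 \<oplus> \<dots> \<oplus> f m\<close>; a semifield has no neutral element for \<open>\<oplus>\<close>.\<close>

primrec sadd_upto :: "('p, 'm) semifield_scheme \<Rightarrow> (nat \<Rightarrow> 'p) \<Rightarrow> nat \<Rightarrow> 'p" where
  "sadd_upto P f 0 = f 0"
| "sadd_upto P f (Suc m) = sadd P (sadd_upto P f m) (f (Suc m))"

inductive_set generated_field :: "'f::field set \<Rightarrow> 'f set" for S where
  base: "a \<in> S \<Longrightarrow> a \<in> generated_field S"
| one: "1 \<in> generated_field S"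
| diff: "\<lbrakk>a \<in> generated_field S; b \<in> generated_field S\<rbrakk> \<Longrightarrow> a - b \<in> generated_field S"
| mult: "\<lbrakk>a \<in> generated_field S; b \<in> generated_field S\<rbrakk> \<Longrightarrow> a * b \<in> generated_field S"
| inverse: "a \<in> generated_field S \<Longrightarrow> inverse a \<in> generated_field S"

text \<open>
  A realisation of \<open>\<rat>P\<close> inside a field: \<open>\<iota>\<close> is multiplicative, and the induced ring homomorphism
  from the group ring \<open>\<int>P\<close> (formal integer combinations of elements of \<open>P\<close>) is injective, so the
  subfield generated by the image of \<open>\<iota>\<close> is the field of fractions of \<open>\<int>P\<close>.
\<close>

locale semifield_embedding = semifield P
  for P :: "('p, 'm) semifield_scheme" (structure) and \<iota> :: "'p \<Rightarrow> 'f::field" +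
  assumes emb_one: "\<iota> \<one> = 1"
    and emb_mult: "\<lbrakk>a \<in> carrier P; b \<in> carrier P\<rbrakk> \<Longrightarrow> \<iota> (a \<otimes> b) = \<iota> a * \<iota> b"
    and emb_group_ring_inj: "\<lbrakk>finite A; A \<subseteq> carrier P; (\<Sum>p\<in>A. of_int (c p) * \<iota> p) = 0; p \<in> A\<rbrakk>
      \<Longrightarrow> (c p :: int) = 0"

definition QP :: "('p, 'm) semifield_scheme \<Rightarrow> ('p \<Rightarrow> 'f::field) \<Rightarrow> 'f set" where
  "QP P \<iota> = generated_field (\<iota> ` carrier P)"


section \<open>Polynomials and rational functions\<close>

type_synonym ('v, 'a) mpoly = "('v \<Rightarrow>\<^sub>0 nat) \<Rightarrow>\<^sub>0 'a"

definition mono_eval :: "('v \<Rightarrow> 'k::comm_ring_1) \<Rightarrow> ('v \<Rightarrow>\<^sub>0 nat) \<Rightarrow> 'k" where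
  "mono_eval \<sigma> m = (\<Prod>v\<in>Poly_Mapping.keys m. \<sigma> v ^ Poly_Mapping.lookup m v)"

definition mpoly_eval :: "('a::zero \<Rightarrow> 'k) \<Rightarrow> ('v \<Rightarrow> 'k::comm_ring_1) \<Rightarrow> ('v, 'a) mpoly \<Rightarrow> 'k" where
  "mpoly_eval h \<sigma> p = (\<Sum>m\<in>Poly_Mapping.keys p. h (Poly_Mapping.lookup p m) * mono_eval \<sigma> m)"

definition alg_independent_over :: "'f::field set \<Rightarrow> nat \<Rightarrow> (nat \<Rightarrow> 'f) \<Rightarrow> bool" where
  "alg_independent_over K n x \<longleftrightarrow>
    (\<forall>p :: (nat, 'f) mpoly.
      (\<forall>m\<in>Poly_Mapping.keys p. Poly_Mapping.lookup p m \<in> K \<and> Poly_Mapping.keys m \<subseteq> {1..n}) \<and>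
      mpoly_eval id x p = 0 \<longrightarrow> p = 0)"

datatype var = XV nat | YV nat | ZV nat nat

text \<open>The order is arbitrary; the library needs one to see that polynomials form a domain.\<close>

fun var_code :: "var \<Rightarrow> nat" where
  "var_code (XV i) = prod_encode (0, i)"
| "var_code (YV i) = prod_encode (1, i)"
| "var_code (ZV i s) = prod_encode (2, prod_encode (i, s))"

lemma var_code_eq_iff: "var_code a = var_code b \<longleftrightarrow> a = b"
  by (cases a; cases b) auto

instantiation var :: linorder
begin

definition less_eq_var :: "var \<Rightarrow> var \<Rightarrow> bool" where
  "less_eq_var a b \<longleftrightarrow> var_code a \<le> var_code b"

definition less_var :: "var \<Rightarrow> var \<Rightarrow> bool" where
  "less_var a b \<longleftrightarrow> var_code a < var_code b"

instance
  by standard (auto simp: less_eq_var_def less_var_def var_code_eq_iff)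

end

text \<open>The rational functions over \<open>\<rat>\<close> in all the variables, as fractions of integer polynomials.\<close>

type_synonym ratfun = "(var, int) mpoly fract"

definition ratfun_of_poly :: "(var, int) mpoly \<Rightarrow> ratfun" where
  "ratfun_of_poly p = Fract p 1"

definition Var :: "var \<Rightarrow> ratfun" where
  "Var v = ratfun_of_poly (Poly_Mapping.single (Poly_Mapping.single v 1) 1)"

text \<open>
  Substitution of \<open>\<sigma> v\<close> for each variable \<open>v\<close> in a rational function. It is meaningful as soon as some
  representation has a denominator that does not vanish under the substitution, and then independent
  of the choice of such a representation; on polynomials it is ordinary evaluation (see below).
\<close>

definition subst :: "(var \<Rightarrow> ratfun) \<Rightarrow> ratfun \<Rightarrow> ratfun" where
  "subst \<sigma> r = (THE v. \<exists>a b. mpoly_eval of_int \<sigma> b \<noteq> 0 \<and> r = Fract a b \<and>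
     v = mpoly_eval of_int \<sigma> a / mpoly_eval of_int \<sigma> b)"

lemma mono_eval_superset:
  assumes "finite A" "Poly_Mapping.keys m \<subseteq> A"
  shows "mono_eval \<sigma> m = (\<Prod>v\<in>A. \<sigma> v ^ Poly_Mapping.lookup m v)"
  unfolding mono_eval_def using assms
  by (intro prod.mono_neutral_left) (auto simp: in_keys_iff)

lemma mono_eval_add: "mono_eval \<sigma> (m + m') = mono_eval \<sigma> m * mono_eval \<sigma> m'"
proof -
  let ?A = "Poly_Mapping.keys m \<union> Poly_Mapping.keys m'"
  have "mono_eval \<sigma> (m + m') = (\<Prod>v\<in>?A. \<sigma> v ^ Poly_Mapping.lookup (m + m') v)"
    using keys_add[of m m'] by (intro mono_eval_superset) auto
  also have "\<dots> = mono_eval \<sigma> m * mono_eval \<sigma> m'"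
    by (simp add: mono_eval_superset[of ?A] lookup_add power_add prod.distrib)
  finally show ?thesis .
qed

lemma mpoly_eval_superset:
  assumes "finite A" "Poly_Mapping.keys p \<subseteq> A"
  shows "mpoly_eval of_int \<sigma> p = (\<Sum>m\<in>A. of_int (Poly_Mapping.lookup p m) * mono_eval \<sigma> m)"
  unfolding mpoly_eval_def using assms
  by (intro sum.mono_neutral_left) (auto simp: in_keys_iff)

lemma mpoly_eval_add: "mpoly_eval of_int \<sigma> (p + q) = mpoly_eval of_int \<sigma> p + mpoly_eval of_int \<sigma> q"
proof -
  let ?A = "Poly_Mapping.keys p \<union> Poly_Mapping.keys q"
  have "mpoly_eval of_int \<sigma> (p + q) =
      (\<Sum>m\<in>?A. of_int (Poly_Mapping.lookup (p + q) m) * mono_eval \<sigma> m)"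
    using keys_add[of p q] by (intro mpoly_eval_superset) auto
  also have "\<dots> = mpoly_eval of_int \<sigma> p + mpoly_eval of_int \<sigma> q"
    by (simp add: mpoly_eval_superset[of ?A] lookup_add algebra_simps sum.distrib)
  finally show ?thesis .
qed

lemma mpoly_eval_single: "mpoly_eval of_int \<sigma> (Poly_Mapping.single m c) = of_int c * mono_eval \<sigma> m"
  by (simp add: mpoly_eval_def)

lemma mpoly_eval_0: "mpoly_eval h \<sigma> 0 = 0"
  by (simp add: mpoly_eval_def)

lemma mpoly_eval_1: "mpoly_eval of_int \<sigma> 1 = 1"
  by (simp add: mpoly_eval_def mono_eval_def)

lemma update_eq_add_single:
  fixes p :: "'k \<Rightarrow>\<^sub>0 'a::monoid_add"
  assumes "k \<notin> Poly_Mapping.keys p"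
  shows "Poly_Mapping.update k c p = p + Poly_Mapping.single k c"
  using assms
  by (intro poly_mapping_eqI) (auto simp: lookup_update lookup_add lookup_single in_keys_iff when_def)

lemma mpoly_eval_mult_single:
  "mpoly_eval of_int \<sigma> (p * Poly_Mapping.single m c) =
    mpoly_eval of_int \<sigma> p * (of_int c * mono_eval \<sigma> m)"
proof (induction p rule: update_induct)
  case const
  then show ?case by (simp add: mpoly_eval_0)
next
  case (update p k b)
  show ?case
    by (simp only: update.IH update_eq_add_single[OF update.hyps(1)] distrib_right mult_single mpoly_eval_add mpoly_eval_single
        mono_eval_add of_int_mult) (simp add: mult_ac)
qed

lemma mpoly_eval_mult: "mpoly_eval of_int \<sigma> (p * q) = mpoly_eval of_int \<sigma> p * mpoly_eval of_int \<sigma> q"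
proof (induction q rule: update_induct)
  case const
  then show ?case by (simp add: mpoly_eval_0)
next
  case (update q k b)
  then show ?case
    by (simp add: update_eq_add_single distrib_left mpoly_eval_add mpoly_eval_single
        mpoly_eval_mult_single)
qed

lemma subst_Fract:
  assumes "mpoly_eval of_int \<sigma> b \<noteq> 0"
  shows "subst \<sigma> (Fract a b) = mpoly_eval of_int \<sigma> a / mpoly_eval of_int \<sigma> b"
  unfolding subst_def
proof (rule the_equality)
  show "\<exists>a' b'. mpoly_eval of_int \<sigma> b' \<noteq> 0 \<and> Fract a b = Fract a' b' \<and>
      mpoly_eval of_int \<sigma> a / mpoly_eval of_int \<sigma> b = mpoly_eval of_int \<sigma> a' / mpoly_eval of_int \<sigma> b'"
    using assms by blast
next
  fix v
  assume "\<exists>a' b'. mpoly_eval of_int \<sigma> b' \<noteq> 0 \<and> Fract a b = Fract a' b' \<and>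
      v = mpoly_eval of_int \<sigma> a' / mpoly_eval of_int \<sigma> b'"
  then obtain a' b' where *: "mpoly_eval of_int \<sigma> b' \<noteq> 0" "Fract a b = Fract a' b'"
      "v = mpoly_eval of_int \<sigma> a' / mpoly_eval of_int \<sigma> b'"
    by blast
  have "b \<noteq> 0" "b' \<noteq> 0"
    using assms *(1) by (auto simp: mpoly_eval_0)
  with *(2) have "a * b' = a' * b"
    by (simp add: eq_fract)
  then have "mpoly_eval of_int \<sigma> a * mpoly_eval of_int \<sigma> b' =
      mpoly_eval of_int \<sigma> a' * mpoly_eval of_int \<sigma> b"
    by (metis mpoly_eval_mult)
  with assms * show "v = mpoly_eval of_int \<sigma> a / mpoly_eval of_int \<sigma> b"
    by (simp add: frac_eq_eq)
qed

lemma subst_ratfun_of_poly: "subst \<sigma> (ratfun_of_poly p) = mpoly_eval of_int \<sigma> p"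
  by (simp add: ratfun_of_poly_def subst_Fract mpoly_eval_1)

text \<open>\<open>Qsf V\<close> is the universal semifield \<open>\<rat>\<^sub>s\<^sub>f(V)\<close>: the subtraction-free rational functions in \<open>V\<close>.\<close>

inductive_set Qsf :: "var set \<Rightarrow> ratfun set" for V where
  one: "1 \<in> Qsf V"
| var: "v \<in> V \<Longrightarrow> Var v \<in> Qsf V"
| add: "\<lbrakk>a \<in> Qsf V; b \<in> Qsf V\<rbrakk> \<Longrightarrow> a + b \<in> Qsf V"
| mult: "\<lbrakk>a \<in> Qsf V; b \<in> Qsf V\<rbrakk> \<Longrightarrow> a * b \<in> Qsf V"
| divide: "\<lbrakk>a \<in> Qsf V; b \<in> Qsf V\<rbrakk> \<Longrightarrow> a / b \<in> Qsf V"


section \<open>Generalized seeds, mutations and patterns\<close>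

text \<open>
  \<open>Z\<^sub>i(u)\<close> is given by its degree \<open>deg S i\<close> and its coefficients \<open>zc S i s\<close> for \<open>s \<le> deg S i\<close>.
\<close>

record ('f, 'p) seed =
  cluster :: "nat \<Rightarrow> 'f"
  coefs :: "nat \<Rightarrow> 'p"
  exmat :: "nat \<Rightarrow> nat \<Rightarrow> int"
  deg :: "nat \<Rightarrow> nat"
  zc :: "nat \<Rightarrow> nat \<Rightarrow> 'p"

definition skew_symmetrizable :: "nat \<Rightarrow> (nat \<Rightarrow> nat \<Rightarrow> int) \<Rightarrow> bool" where
  "skew_symmetrizable n B \<longleftrightarrow>
    (\<exists>r :: nat \<Rightarrow> int. (\<forall>i\<in>{1..n}. r i > 0) \<and>
      (\<forall>i\<in>{1..n}. \<forall>j\<in>{1..n}. r i * B i j = - (r j * B j i)))"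

locale generalized_seed = semifield_embedding P \<iota>
  for P :: "('p, 'm) semifield_scheme" (structure) and \<iota> :: "'p \<Rightarrow> 'f::field" +
  fixes F :: "'f set" and n :: nat and S :: "('f, 'p) seed"
  assumes ambient_field: "F = generated_field (QP P \<iota> \<union> cluster S ` {1..n})"
    and cluster_independent: "alg_independent_over (QP P \<iota>) n (cluster S)"
    and coefs_closed: "i \<in> {1..n} \<Longrightarrow> coefs S i \<in> carrier P"
    and exmat_skew: "skew_symmetrizable n (exmat S)"
    and deg_pos: "i \<in> {1..n} \<Longrightarrow> deg S i \<ge> 1"
    and zc_closed: "\<lbrakk>i \<in> {1..n}; s \<le> deg S i\<rbrakk> \<Longrightarrow> zc S i s \<in> carrier P"
    and zc_first: "i \<in> {1..n} \<Longrightarrow> zc S i 0 = \<one>"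
    and zc_last: "i \<in> {1..n} \<Longrightarrow> zc S i (deg S i) = \<one>"

definition pos_part :: "int \<Rightarrow> int" where
  "pos_part b = max b 0"

definition yhat :: "('p \<Rightarrow> 'f::field) \<Rightarrow> nat \<Rightarrow> ('f, 'p) seed \<Rightarrow> nat \<Rightarrow> 'f" where
  "yhat \<iota> n S k = \<iota> (coefs S k) * (\<Prod>i\<in>{1..n}. cluster S i powi exmat S i k)"

definition Z_field :: "('p \<Rightarrow> 'f::field) \<Rightarrow> ('f, 'p) seed \<Rightarrow> nat \<Rightarrow> 'f \<Rightarrow> 'f" where
  "Z_field \<iota> S k u = (\<Sum>s\<le>deg S k. \<iota> (zc S k s) * u ^ s)"

definition Z_semifield :: "('p, 'm) semifield_scheme \<Rightarrow> ('f, 'p) seed \<Rightarrow> nat \<Rightarrow> 'p \<Rightarrow> 'p" where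
  "Z_semifield P S k y = sadd_upto P (\<lambda>s. zc S k s \<otimes>\<^bsub>P\<^esub> y [^]\<^bsub>P\<^esub> s) (deg S k)"

definition mutate ::
  "('p, 'm) semifield_scheme \<Rightarrow> ('p \<Rightarrow> 'f::field) \<Rightarrow> nat \<Rightarrow> nat \<Rightarrow> ('f, 'p) seed \<Rightarrow> ('f, 'p) seed" where
  "mutate P \<iota> n k S =
    (let x = cluster S; y = coefs S; B = exmat S; d = deg S; z = zc S;
         Zk = Z_semifield P S k (y k) in
     \<lparr> cluster = (\<lambda>i. if i = k
         then (\<Prod>l\<in>{1..n}. x l powi pos_part (- B l k)) ^ d k
              * (Z_field \<iota> S k (yhat \<iota> n S k) / \<iota> Zk) / x k
         else x i),
       coefs = (\<lambda>j. if j = k then inv\<^bsub>P\<^esub> (y k)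
         else y j \<otimes>\<^bsub>P\<^esub> (y k [^]\<^bsub>P\<^esub> d k) [^]\<^bsub>P\<^esub> pos_part (B k j) \<otimes>\<^bsub>P\<^esub> Zk [^]\<^bsub>P\<^esub> (- B k j)),
       exmat = (\<lambda>i j. if i = k \<or> j = k then - B i j
         else B i j + pos_part (B i k) * int (d k) * B k j + B i k * int (d k) * pos_part (- B k j)),
       deg = d,
       zc = (\<lambda>i s. if i = k \<and> s \<le> d k then z k (d k - s) else z i s) \<rparr>)"

text \<open>
  The vertices of the \<open>n\<close>-regular tree are the words in the labels \<open>1, \<dots>, n\<close> without two equal adjacent
  letters: a vertex is the list of the edge labels on the path that joins it to the root \<open>t\<^sub>0 = []\<close>,
  the edge at the vertex itself coming first.
\<close>

definition tree :: "nat \<Rightarrow> nat list set" where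
  "tree n = {t. set t \<subseteq> {1..n} \<and> distinct_adj t}"

definition tree_edge :: "nat \<Rightarrow> nat \<Rightarrow> nat list \<Rightarrow> nat list \<Rightarrow> bool" where
  "tree_edge n k t t' \<longleftrightarrow> t \<in> tree n \<and> t' \<in> tree n \<and> (t' = k # t \<or> t = k # t')"

definition cluster_pattern ::
  "('p, 'm) semifield_scheme \<Rightarrow> ('p \<Rightarrow> 'f::field) \<Rightarrow> nat \<Rightarrow> (nat list \<Rightarrow> ('f, 'p) seed) \<Rightarrow> bool" where
  "cluster_pattern P \<iota> n \<Sigma> \<longleftrightarrow>
    (\<forall>k t t'. tree_edge n k t t' \<longrightarrow> \<Sigma> t' = mutate P \<iota> n k (\<Sigma> t))"

text \<open>The pattern with initial seed \<open>S\<close>; by the lemma below there is no other.\<close>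

primrec seed_at ::
  "('p, 'm) semifield_scheme \<Rightarrow> ('p \<Rightarrow> 'f::field) \<Rightarrow> nat \<Rightarrow> ('f, 'p) seed \<Rightarrow> nat list \<Rightarrow> ('f, 'p) seed" where
  "seed_at P \<iota> n S [] = S"
| "seed_at P \<iota> n S (k # t) = mutate P \<iota> n k (seed_at P \<iota> n S t)"

lemma cluster_pattern_unique:
  assumes "cluster_pattern P \<iota> n \<Sigma>" "t \<in> tree n"
  shows "\<Sigma> t = seed_at P \<iota> n (\<Sigma> []) t"
  using assms(2)
proof (induction t)
  case Nil
  then show ?case by simp
next
  case (Cons k t)
  then have "t \<in> tree n" by (auto simp: tree_def distinct_adj_Cons)
  with Cons.prems have "tree_edge n k t (k # t)" by (simp add: tree_edge_def)
  with assms(1) have "\<Sigma> (k # t) = mutate P \<iota> n k (\<Sigma> t)"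
    unfolding cluster_pattern_def by blast
  with Cons.IH \<open>t \<in> tree n\<close> show ?case by simp
qed


section \<open>Tropical semifields and \<open>F\<close>-polynomials\<close>

text \<open>A Laurent monomial in the variables \<open>V\<close> is represented by its exponent vector.\<close>

definition Trop :: "var set \<Rightarrow> (var \<Rightarrow> int) semifield" where
  "Trop V = \<lparr> carrier = {a. \<forall>v. v \<notin> V \<longrightarrow> a v = 0}, mult = (\<lambda>a b v. a v + b v), one = (\<lambda>v. 0),
     sadd = (\<lambda>a b v. min (a v) (b v)) \<rparr>"

lemma semifield_Trop: "semifield (Trop V)"
proof -
  interpret comm_group "Trop V"
  proof (rule comm_groupI)
    fix x assume "x \<in> carrier (Trop V)"
    then show "\<exists>y\<in>carrier (Trop V). y \<otimes>\<^bsub>Trop V\<^esub> x = \<one>\<^bsub>Trop V\<^esub>"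
      by (intro bexI[of _ "\<lambda>v. - x v"]) (auto simp: Trop_def)
  qed (auto simp: Trop_def fun_eq_iff)
  show ?thesis
    by unfold_locales (auto simp: Trop_def fun_eq_iff min_def)
qed

definition trop_var :: "var \<Rightarrow> (var \<Rightarrow> int)" where
  "trop_var v = (\<lambda>w. if w = v then 1 else 0)"

definition trop_emb :: "var set \<Rightarrow> (var \<Rightarrow> int) \<Rightarrow> ratfun" where
  "trop_emb V a = (\<Prod>v\<in>V. Var v powi a v)"

definition y_vars :: "nat \<Rightarrow> var set" where
  "y_vars n = {YV i |i. i \<in> {1..n}}"

definition z_vars :: "nat \<Rightarrow> (nat \<Rightarrow> nat) \<Rightarrow> var set" where
  "z_vars n d = {ZV i s |i s. i \<in> {1..n} \<and> 0 < s \<and> s < d i}"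

definition x_vars :: "nat \<Rightarrow> var set" where
  "x_vars n = {XV i |i. i \<in> {1..n}}"

definition initial_seed :: "(nat \<Rightarrow> nat \<Rightarrow> int) \<Rightarrow> (nat \<Rightarrow> nat) \<Rightarrow> (ratfun, var \<Rightarrow> int) seed" where
  "initial_seed B d = \<lparr> cluster = (\<lambda>i. Var (XV i)), coefs = (\<lambda>i. trop_var (YV i)),
     exmat = B, deg = d, zc = (\<lambda>i s. if 0 < s \<and> s < d i then trop_var (ZV i s) else (\<lambda>v. 0)) \<rparr>"

definition X_function ::
  "nat \<Rightarrow> (nat \<Rightarrow> nat \<Rightarrow> int) \<Rightarrow> (nat \<Rightarrow> nat) \<Rightarrow> nat list \<Rightarrow> nat \<Rightarrow> ratfun" where
  "X_function n B d t j =
    (let V = y_vars n \<union> z_vars n d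
     in cluster (seed_at (Trop V) (trop_emb V) n (initial_seed B d) t) j)"

text \<open>
  The \<open>F\<close>-polynomials are kept as elements of the field of rational functions; that they are
  polynomials in \<open>\<bold>y, \<bold>z\<close> is a theorem and not part of the definition.
\<close>

definition F_polynomial ::
  "nat \<Rightarrow> (nat \<Rightarrow> nat \<Rightarrow> int) \<Rightarrow> (nat \<Rightarrow> nat) \<Rightarrow> nat list \<Rightarrow> nat \<Rightarrow> ratfun" where
  "F_polynomial n B d t j =
    subst (\<lambda>v. case v of XV i \<Rightarrow> 1 | YV i \<Rightarrow> Var (YV i) | ZV i s \<Rightarrow> Var (ZV i s))
      (X_function n B d t j)"

text \<open>\<open>F(\<bold>a, \<bold>0)\<close>; for an ordinary pattern there are no variables \<open>z\<^sub>i\<^sub>,\<^sub>s\<close>, and this is \<open>F(\<bold>a)\<close>.\<close>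

definition eval_at_z0 :: "ratfun \<Rightarrow> (nat \<Rightarrow> ratfun) \<Rightarrow> ratfun" where
  "eval_at_z0 f a = subst (\<lambda>v. case v of XV i \<Rightarrow> Var (XV i) | YV i \<Rightarrow> a i | ZV i s \<Rightarrow> 0) f"

definition F_poly_of_seed :: "nat \<Rightarrow> ('f, 'p) seed \<Rightarrow> nat list \<Rightarrow> nat \<Rightarrow> ratfun" where
  "F_poly_of_seed n S = F_polynomial n (exmat S) (deg S)"

text \<open>The ordinary seed \<open>(\<bold>x, \<bold>y\<^sup>\<bold>d, BD)\<close>, with all exchange polynomials equal to \<open>1 + u\<close>.\<close>

definition right_companion :: "('p, 'm) semifield_scheme \<Rightarrow> ('f, 'p) seed \<Rightarrow> ('f, 'p) seed" where
  "right_companion P S = \<lparr> cluster = cluster S, coefs = (\<lambda>i. coefs S i [^]\<^bsub>P\<^esub> deg S i),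
     exmat = (\<lambda>i j. exmat S i j * int (deg S j)), deg = (\<lambda>i. 1), zc = (\<lambda>i s. \<one>\<^bsub>P\<^esub>) \<rparr>"

definition yhat_var :: "nat \<Rightarrow> (nat \<Rightarrow> nat \<Rightarrow> int) \<Rightarrow> nat \<Rightarrow> ratfun" where
  "yhat_var n B i = Var (YV i) * (\<Prod>l\<in>{1..n}. Var (XV l) powi B l i)"

end

theory Submission
  imports "HOL.Rat" Defs
begin

text \<open>
  Setting \<open>\<bold>z = \<bold>0\<close> in a rational function is only a partial operation, so it is treated as a place: a
  partial homomorphism of fields whose domain is closed under inverting elements of nonzero value.
  Tropically, \<open>z\<^sub>k\<^sub>,\<^sub>s y\<^sub>k\<^sup>s\<close> with \<open>0 < s < d\<^sub>k\<close> never contributes to the minimum, because \<open>s c\<close> lies between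
  \<open>0\<close> and \<open>d\<^sub>k c\<close>; hence the coefficients do not involve \<open>\<bold>z\<close>, and \<open>\<bold>y\<^sup>\<bold>d\<close> mutates like the coefficients of
  the right companion. At \<open>\<bold>z = \<bold>0\<close> the exchange polynomial \<open>Z\<^sub>k(u)\<close> becomes \<open>1 + u\<^sup>d\<close>, so the exchange relations
  of both patterns agree. The values of the cluster variables stay subtraction-free, hence nonzero, which
  lets the place be applied to the next mutation; polynomiality of \<open>F\<close> is not needed.
\<close>

section \<open>Places\<close>

locale place =
  fixes R :: "'a::field \<Rightarrow> 'b::field \<Rightarrow> bool"
  assumes one: "R 1 1"
    and zero_iff: "R 0 w \<longleftrightarrow> w = 0"
    and add: "\<lbrakk>R a v; R b w\<rbrakk> \<Longrightarrow> R (a + b) (v + w)"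
    and mult: "\<lbrakk>R a v; R b w\<rbrakk> \<Longrightarrow> R (a * b) (v * w)"
    and inverse: "\<lbrakk>R a v; v \<noteq> 0\<rbrakk> \<Longrightarrow> R (inverse a) (inverse v)"
begin

lemma divide: "\<lbrakk>R a v; R b w; w \<noteq> 0\<rbrakk> \<Longrightarrow> R (a / b) (v / w)"
  by (simp add: divide_inverse mult inverse)

lemma power: "R a v \<Longrightarrow> R (a ^ m) (v ^ m)"
  by (induction m) (auto simp: one mult)

lemma powi: "\<lbrakk>R a v; v \<noteq> 0\<rbrakk> \<Longrightarrow> R (a powi m) (v powi m)"
  by (simp add: power_int_def power inverse)

lemma prod: "(\<And>i. i \<in> A \<Longrightarrow> R (f i) (g i)) \<Longrightarrow> R (\<Prod>i\<in>A. f i) (\<Prod>i\<in>A. g i)"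
  by (induction A rule: infinite_finite_induct) (auto simp: one mult)

lemma sum: "(\<And>i. i \<in> A \<Longrightarrow> R (f i) (g i)) \<Longrightarrow> R (\<Sum>i\<in>A. f i) (\<Sum>i\<in>A. g i)"
  by (induction A rule: infinite_finite_induct) (auto simp: zero_iff add)

end

text \<open>A nonzero final value has a nonzero intermediate value by \<open>zero_iff\<close>, so
  inversion passes through both relations. Two successive substitutions call for this
  closure.\<close>

lemma place_relcompp:
  assumes "place R" "place R'"
  shows "place (R OO R')"
proof -
  interpret R: place R by fact
  interpret R': place R' by fact
  show ?thesis
  proof
    fix a v assume "(R OO R') a v" "v \<noteq> 0"
    then obtain u where u: "R a u" "R' u v" by blast
    with \<open>v \<noteq> 0\<close> have "u \<noteq> 0" by (auto simp: R'.zero_iff)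
    with u \<open>v \<noteq> 0\<close> show "(R OO R') (inverse a) (inverse v)"
      by (blast intro: R.inverse R'.inverse)
  qed (blast intro: R.one R'.one R.add R'.add R.mult R'.mult
      | simp add: relcompp_apply R.zero_iff R'.zero_iff)+
qed

text \<open>The graph of \<open>subst\<close> as a relation, but with values in an arbitrary field:
  having a value becomes part of the assertion, and evaluation at rational numbers is covered
  too.\<close>

definition specializes :: "(var \<Rightarrow> 'k::field) \<Rightarrow> ratfun \<Rightarrow> 'k \<Rightarrow> bool" where
  "specializes \<sigma> r v \<longleftrightarrow> (\<exists>a b. mpoly_eval of_int \<sigma> b \<noteq> 0 \<and> r = Fract a b \<and>
     v = mpoly_eval of_int \<sigma> a / mpoly_eval of_int \<sigma> b)"

lemma specializesI:
  "\<lbrakk>mpoly_eval of_int \<sigma> b \<noteq> 0; r = Fract a b; v = mpoly_eval of_int \<sigma> a / mpoly_eval of_int \<sigma> b\<rbrakk>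
    \<Longrightarrow> specializes \<sigma> r v"
  unfolding specializes_def by blast

lemma specializesE:
  assumes "specializes \<sigma> r v"
  obtains a b where "mpoly_eval of_int \<sigma> b \<noteq> 0" "b \<noteq> 0" "r = Fract a b"
    "v = mpoly_eval of_int \<sigma> a / mpoly_eval of_int \<sigma> b"
  using assms unfolding specializes_def by (metis mpoly_eval_0)

text \<open>Products of denominators keep nonzero values because the target is a field. A nonzero
  value forces the numerator to evaluate to a nonzero element, so numerator and denominator may be
  swapped.\<close>

lemma place_specializes: "place (specializes \<sigma>)"
proof
  show "specializes \<sigma> 1 1"
    by (rule specializesI[of _ 1 _ 1]) (simp_all add: mpoly_eval_1 One_fract_def)
next
  fix w
  show "specializes \<sigma> 0 w \<longleftrightarrow> w = 0"
  proof
    assume "specializes \<sigma> 0 w"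
    then show "w = 0"
      by (elim specializesE) (simp add: Zero_fract_def eq_fract mpoly_eval_0)
  next
    assume "w = 0"
    then show "specializes \<sigma> 0 w"
      by (intro specializesI[of _ 1 _ 0]) (simp_all add: mpoly_eval_1 mpoly_eval_0 Zero_fract_def)
  qed
next
  fix r v s w assume "specializes \<sigma> r v" "specializes \<sigma> s w"
  then obtain a b c e where *: "mpoly_eval of_int \<sigma> b \<noteq> 0" "b \<noteq> 0" "r = Fract a b"
      "v = mpoly_eval of_int \<sigma> a / mpoly_eval of_int \<sigma> b"
      "mpoly_eval of_int \<sigma> e \<noteq> 0" "e \<noteq> 0" "s = Fract c e"
      "w = mpoly_eval of_int \<sigma> c / mpoly_eval of_int \<sigma> e"
    by (elim specializesE)
  show "specializes \<sigma> (r + s) (v + w)"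
    by (rule specializesI[of _ "b * e" _ "a * e + c * b"])
      (use * in \<open>simp_all add: mpoly_eval_mult mpoly_eval_add add_frac_eq\<close>)
  show "specializes \<sigma> (r * s) (v * w)"
    by (rule specializesI[of _ "b * e" _ "a * c"]) (use * in \<open>simp_all add: mpoly_eval_mult\<close>)
next
  fix r v assume "specializes \<sigma> r v" "v \<noteq> 0"
  then show "specializes \<sigma> (inverse r) (inverse v)"
    by (elim specializesE) (auto intro!: specializesI)
qed

lemma specializes_Var: "specializes \<sigma> (Var v) (\<sigma> v)"
  by (rule specializesI[of _ 1 _ "Poly_Mapping.single (Poly_Mapping.single v 1) 1"])
    (simp_all add: mpoly_eval_1 mpoly_eval_single mono_eval_def Var_def ratfun_of_poly_def)

lemma subst_eqI: "specializes \<sigma> r v \<Longrightarrow> subst \<sigma> r = v"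
  by (elim specializesE) (simp add: subst_Fract)


section \<open>Subtraction-free rational functions\<close>

text \<open>Sums, products and quotients of positive elements are positive, so no denominator met
  along a subtraction-free construction becomes zero.\<close>

lemma Qsf_specializes_pos:
  fixes \<sigma> :: "var \<Rightarrow> 'k::linordered_field"
  assumes "r \<in> Qsf V" "\<And>v. v \<in> V \<Longrightarrow> \<sigma> v > 0"
  shows "\<exists>q>0. specializes \<sigma> r q"
proof -
  interpret place "specializes \<sigma>" by (rule place_specializes)
  note specializes_one = one and place_ops = add mult divide
  show ?thesis
    using assms(1)
  proof induction
    case one
    show ?case using specializes_one zero_less_one by blast
  next
    case (var v)
    then show ?case using specializes_Var assms(2) by blast
  next
    case (add a b)
    then obtain p q where "p > 0" "q > 0" "specializes \<sigma> a p" "specializes \<sigma> b q" by blast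
    then have "p + q > 0" "specializes \<sigma> (a + b) (p + q)" by (auto intro: place_ops)
    then show ?case by blast
  next
    case (mult a b)
    then obtain p q where "p > 0" "q > 0" "specializes \<sigma> a p" "specializes \<sigma> b q" by blast
    then have "p * q > 0" "specializes \<sigma> (a * b) (p * q)" by (auto intro: place_ops)
    then show ?case by blast
  next
    case (divide a b)
    then obtain p q where "p > 0" "q > 0" "specializes \<sigma> a p" "specializes \<sigma> b q" by blast
    then have "p / q > 0" "specializes \<sigma> (a / b) (p / q)" by (auto intro: place_ops)
    then show ?case by blast
  qed
qed

text \<open>At the rational point with all coordinates 1 the value is positive, whereas 0
  specializes only to 0.\<close>

lemma Qsf_nonzero:
  assumes "r \<in> Qsf V"
  shows "r \<noteq> 0"
proof
  assume "r = 0"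
  obtain q where "q > 0" "specializes (\<lambda>_. 1 :: rat) r q"
    using Qsf_specializes_pos[OF assms, of "\<lambda>_. 1 :: rat"] by auto
  with \<open>r = 0\<close> show False
    by (simp add: place.zero_iff[OF place_specializes])
qed

lemma Qsf_power: "a \<in> Qsf V \<Longrightarrow> a ^ m \<in> Qsf V"
  by (induction m) (auto intro: Qsf.intros)

lemma Qsf_powi:
  assumes "a \<in> Qsf V"
  shows "a powi m \<in> Qsf V"
proof -
  have "inverse a \<in> Qsf V"
    using Qsf.divide[OF Qsf.one assms] by (simp add: inverse_eq_divide)
  then show ?thesis
    using assms by (simp add: power_int_def Qsf_power)
qed

lemma Qsf_prod: "(\<And>i. i \<in> A \<Longrightarrow> f i \<in> Qsf V) \<Longrightarrow> (\<Prod>i\<in>A. f i) \<in> Qsf V"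
  by (induction A rule: infinite_finite_induct) (auto intro: Qsf.intros)


section \<open>Tropical semifields\<close>

lemma Trop_simps:
  "a \<in> carrier (Trop V) \<longleftrightarrow> (\<forall>v. v \<notin> V \<longrightarrow> a v = 0)"
  "a \<otimes>\<^bsub>Trop V\<^esub> b = (\<lambda>v. a v + b v)" "\<one>\<^bsub>Trop V\<^esub> = (\<lambda>v. 0)"
  "sadd (Trop V) a b = (\<lambda>v. min (a v) (b v))"
  by (simp_all add: Trop_def)

lemma Trop_nat_pow: "a [^]\<^bsub>Trop V\<^esub> (m :: nat) = (\<lambda>v. int m * a v)"
  by (induction m) (simp_all add: nat_pow_def Trop_simps algebra_simps fun_eq_iff)

lemma Trop_inv:
  assumes "a \<in> carrier (Trop V)"
  shows "inv\<^bsub>Trop V\<^esub> a = (\<lambda>v. - a v)"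
proof -
  interpret semifield "Trop V" by (rule semifield_Trop)
  show ?thesis
    by (rule inv_equality) (use assms in \<open>auto simp: Trop_simps\<close>)
qed

lemma Trop_int_pow:
  assumes "a \<in> carrier (Trop V)"
  shows "a [^]\<^bsub>Trop V\<^esub> (m :: int) = (\<lambda>v. m * a v)"
proof (cases "m < 0")
  case True
  have "(\<lambda>v. int (nat (- m)) * a v) \<in> carrier (Trop V)"
    using assms by (simp only: Trop_simps) simp
  from Trop_inv[OF this] show ?thesis
    using True by (simp only: int_pow_def2 Trop_nat_pow) simp
next
  case False
  then show ?thesis by (simp add: int_pow_def2 Trop_nat_pow)
qed

lemma sadd_upto_Trop: "sadd_upto (Trop V) f m v = Min ((\<lambda>s. f s v) ` {..m})"
  by (induction m) (simp_all add: Trop_simps atMost_Suc min.commute)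

text \<open>Only the sign of the inner exponents enters, so the formula serves a generalized
  exchange polynomial, its reversal and 1 + u alike.\<close>

lemma Z_semifield_Trop:
  assumes "\<forall>s\<le>deg S k. \<forall>v. zc S k s v \<ge> 0"
    and "zc S k 0 = (\<lambda>v. 0)" "zc S k (deg S k) = (\<lambda>v. 0)"
  shows "Z_semifield (Trop V) S k y = (\<lambda>v. min 0 (int (deg S k) * y v))"
proof
  fix v
  let ?d = "deg S k" and ?f = "\<lambda>s. zc S k s v + int s * y v"
  have "min 0 (int ?d * y v) \<le> ?f s" if "s \<le> ?d" for s
  proof (cases "y v \<ge> 0")
    case True
    then show ?thesis using assms(1)[rule_format, OF that, of v] by (simp add: min_def)
  next
    case False
    then have "int ?d * y v \<le> int s * y v"
      using that by (simp add: mult_right_mono_neg)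
    then show ?thesis using assms(1)[rule_format, OF that, of v] by linarith
  qed
  \<comment> \<open>The bound is attained at s = 0 if \<open>y v\<close> is nonnegative and at s =
    \<open>?d\<close> otherwise.\<close>
  moreover have "min 0 (int ?d * y v) \<in> ?f ` {..?d}"
    using assms(2,3) by (auto simp: min_def intro: rev_image_eqI[of 0] rev_image_eqI[of ?d])
  ultimately have "Min (?f ` {..?d}) = min 0 (int ?d * y v)"
    by (intro Min_eqI) auto
  then show "Z_semifield (Trop V) S k y v = min 0 (int ?d * y v)"
    by (simp add: Z_semifield_def sadd_upto_Trop Trop_simps Trop_nat_pow)
qed


text \<open>On exponent vectors coefficient mutation is a piecewise linear integer rule, so the two
  patterns can be compared exponent by exponent.\<close>

lemma coefs_mutate_Trop:
  assumes "coefs S k \<in> carrier (Trop V)"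
    and "\<forall>s\<le>deg S k. \<forall>v. zc S k s v \<ge> 0"
    and "zc S k 0 = (\<lambda>v. 0)" "zc S k (deg S k) = (\<lambda>v. 0)"
  shows "coefs (mutate (Trop V) \<iota> n k S) j =
    (if j = k then (\<lambda>v. - coefs S k v)
     else (\<lambda>v. coefs S j v + pos_part (exmat S k j) * (int (deg S k) * coefs S k v)
            - exmat S k j * min 0 (int (deg S k) * coefs S k v)))"
proof -
  have "(\<lambda>v. int (deg S k) * coefs S k v) \<in> carrier (Trop V)"
    "(\<lambda>v. min 0 (int (deg S k) * coefs S k v)) \<in> carrier (Trop V)"
    using assms(1) by (simp_all add: Trop_simps)
  then show ?thesis
    using assms(1)
    by (auto simp: mutate_def Let_def Z_semifield_Trop[OF assms(2-4)] Trop_inv Trop_int_pow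
        Trop_nat_pow Trop_simps(2))
qed

section \<open>Tropical monomials as rational functions\<close>

lemma finite_y_vars: "finite (y_vars n)"
  by (simp add: y_vars_def)

lemma finite_z_vars: "finite (z_vars n d)"
proof -
  have "z_vars n d \<subseteq> (\<lambda>(i, s). ZV i s) ` (SIGMA i:{1..n}. {..<d i})"
    by (auto simp: z_vars_def)
  then show ?thesis by (rule finite_subset) auto
qed

lemma prod_y_vars: "(\<Prod>v\<in>y_vars n. f v) = (\<Prod>i\<in>{1..n}. f (YV i))"
proof -
  have "y_vars n = YV ` {1..n}" by (auto simp: y_vars_def)
  then show ?thesis by (simp add: prod.reindex inj_on_def)
qed

lemma trop_emb_trop_var:
  assumes "finite V" "v \<in> V"
  shows "trop_emb V (trop_var v) = Var v"
proof -
  have "trop_emb V (trop_var v) = (\<Prod>w\<in>V. if w = v then Var w else 1)"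
    unfolding trop_emb_def trop_var_def by (rule prod.cong) auto
  then show ?thesis using assms by simp
qed


section \<open>Comparison with the right companion\<close>

text \<open>The two factors are the substitutions in \<open>F_polynomial\<close> and
  \<open>eval_at_z0\<close>. Composing them supplies the intermediate value to which the outer
  \<open>subst\<close> is applied.\<close>

definition z0_place :: "(nat \<Rightarrow> ratfun) \<Rightarrow> ratfun \<Rightarrow> ratfun \<Rightarrow> bool" where
  "z0_place a =
    specializes (\<lambda>v. case v of XV i \<Rightarrow> 1 | YV i \<Rightarrow> Var (YV i) | ZV i s \<Rightarrow> Var (ZV i s)) OO
    specializes (\<lambda>v. case v of XV i \<Rightarrow> Var (XV i) | YV i \<Rightarrow> a i | ZV i s \<Rightarrow> 0)"

lemma place_z0_place: "place (z0_place a)"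
  unfolding z0_place_def by (intro place_relcompp place_specializes)

lemma z0_place_Var:
  "z0_place a (Var (XV i)) 1" "z0_place a (Var (YV i)) (a i)" "z0_place a (Var (ZV i s)) 0"
proof -
  let ?\<sigma> = "\<lambda>v. case v of XV i \<Rightarrow> 1 | YV i \<Rightarrow> Var (YV i) | ZV i s \<Rightarrow> Var (ZV i s)"
  let ?\<tau> = "\<lambda>v. case v of XV i \<Rightarrow> Var (XV i) | YV i \<Rightarrow> a i | ZV i s \<Rightarrow> 0"
  show "z0_place a (Var (XV i)) 1"
    using specializes_Var[of ?\<sigma> "XV i"] place.one[OF place_specializes, of ?\<tau>]
    by (auto simp: z0_place_def)
  show "z0_place a (Var (YV i)) (a i)"
    using specializes_Var[of ?\<sigma> "YV i"] specializes_Var[of ?\<tau> "YV i"] by (auto simp: z0_place_def)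
  show "z0_place a (Var (ZV i s)) 0"
    using specializes_Var[of ?\<sigma> "ZV i s"] specializes_Var[of ?\<tau> "ZV i s"] by (auto simp: z0_place_def)
qed

lemma eval_at_z0_F_polynomial:
  "z0_place a (X_function n B d t j) w \<Longrightarrow> eval_at_z0 (F_polynomial n B d t j) a = w"
  unfolding z0_place_def eval_at_z0_def F_polynomial_def by (auto simp: subst_eqI)

text \<open>A negative power of a z-variable would have no value at z = 0; a Laurent monomial in y
  alone has one as soon as the \<open>a i\<close> are nonzero.\<close>

lemma z0_place_trop_emb:
  assumes "finite V" "y_vars n \<subseteq> V" "\<And>v. v \<notin> y_vars n \<Longrightarrow> c v = 0"
    and "\<And>i. i \<in> {1..n} \<Longrightarrow> a i \<noteq> 0"
  shows "z0_place a (trop_emb V c) (\<Prod>i\<in>{1..n}. a i powi c (YV i))"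
proof -
  interpret place "z0_place a" by (rule place_z0_place)
  have "trop_emb V c = (\<Prod>v\<in>y_vars n. Var v powi c v)"
    unfolding trop_emb_def using assms(1-3) by (intro prod.mono_neutral_right) auto
  then show ?thesis
    by (simp only: prod_y_vars) (intro prod powi z0_place_Var assms(4))
qed

lemma pos_part_mult: "pos_part (b * int m) = pos_part b * int m"
  by (auto simp: pos_part_def max_def zero_le_mult_iff mult_le_0_iff)

text \<open>The invariant of the comparison; \<open>G\<close> runs through the generalized pattern and \<open>R\<close> through its companion.\<close>

definition companion_related ::
  "nat \<Rightarrow> (nat \<Rightarrow> nat) \<Rightarrow> (nat \<Rightarrow> ratfun) \<Rightarrow> var set \<Rightarrow>
    (ratfun, var \<Rightarrow> int) seed \<Rightarrow> (ratfun, var \<Rightarrow> int) seed \<Rightarrow> bool" where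
  "companion_related n d a W G R \<longleftrightarrow>
    deg G = d \<and> deg R = (\<lambda>i. 1) \<and>
    (\<forall>i\<in>{1..n}. \<forall>j\<in>{1..n}. exmat R i j = exmat G i j * int (d j)) \<and>
    (\<forall>j\<in>{1..n}. \<forall>v. v \<notin> y_vars n \<longrightarrow> coefs G j v = 0 \<and> coefs R j v = 0) \<and>
    (\<forall>j\<in>{1..n}. \<forall>i\<in>{1..n}. int (d j) * coefs G j (YV i) = int (d i) * coefs R j (YV i)) \<and>
    (\<forall>k\<in>{1..n}. zc G k 0 = (\<lambda>v. 0) \<and> zc G k (d k) = (\<lambda>v. 0) \<and>
      (\<forall>s. 0 < s \<and> s < d k \<longrightarrow> (\<exists>s'. 0 < s' \<and> s' < d k \<and> zc G k s = trop_var (ZV k s')))) \<and>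
    (\<forall>k s. zc R k s = (\<lambda>v. 0)) \<and>
    (\<forall>j\<in>{1..n}. \<exists>w\<in>Qsf W. z0_place a (cluster G j) w \<and> z0_place (\<lambda>i. a i ^ d i) (cluster R j) w)"

lemma companion_related_initial:
  assumes "\<And>i. i \<in> {1..n} \<Longrightarrow> d i \<ge> 1"
  shows "companion_related n d a W (initial_seed B d)
    (initial_seed (\<lambda>i j. B i j * int (d j)) (\<lambda>i. 1))"
  unfolding companion_related_def initial_seed_def
  by (auto simp: trop_var_def y_vars_def intro: Qsf.one z0_place_Var)

text \<open>The coefficient clause of the invariant reads: \<open>coefs G j\<close> to the power
  \<open>d j\<close> is \<open>coefs R j\<close> with each \<open>YV i\<close> replaced by its power
  \<open>d i\<close>. It makes every factor of the two exchange relations take the same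
  value.\<close>

lemma companion_related_mutate:
  assumes rel: "companion_related n d a W G R" and k: "k \<in> {1..n}"
    and d: "\<And>i. i \<in> {1..n} \<Longrightarrow> d i \<ge> 1" and a: "\<And>i. i \<in> {1..n} \<Longrightarrow> a i \<in> Qsf W"
    and V: "V = y_vars n \<union> z_vars n d" and V': "V' = y_vars n"
  shows "companion_related n d a W (mutate (Trop V) (trop_emb V) n k G)
    (mutate (Trop V') (trop_emb V') n k R)"
    (is "companion_related n d a W ?G' ?R'")
proof -
  let ?a' = "\<lambda>i. a i ^ d i"
  interpret G: place "z0_place a" by (rule place_z0_place)
  interpret R: place "z0_place ?a'" by (rule place_z0_place)
  have degs: "deg G = d" "deg R = (\<lambda>i. 1)"
    and B: "\<And>i j. \<lbrakk>i \<in> {1..n}; j \<in> {1..n}\<rbrakk> \<Longrightarrow> exmat R i j = exmat G i j * int (d j)"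
    and supp: "\<And>j v. \<lbrakk>j \<in> {1..n}; v \<notin> y_vars n\<rbrakk> \<Longrightarrow> coefs G j v = 0"
      "\<And>j v. \<lbrakk>j \<in> {1..n}; v \<notin> y_vars n\<rbrakk> \<Longrightarrow> coefs R j v = 0"
    and c: "\<And>i j. \<lbrakk>i \<in> {1..n}; j \<in> {1..n}\<rbrakk> \<Longrightarrow>
      int (d j) * coefs G j (YV i) = int (d i) * coefs R j (YV i)"
    and z: "\<And>i. i \<in> {1..n} \<Longrightarrow> zc G i 0 = (\<lambda>v. 0)" "\<And>i. i \<in> {1..n} \<Longrightarrow> zc G i (d i) = (\<lambda>v. 0)"
      "\<And>i s. \<lbrakk>i \<in> {1..n}; 0 < s; s < d i\<rbrakk> \<Longrightarrow> \<exists>s'. 0 < s' \<and> s' < d i \<and> zc G i s = trop_var (ZV i s')"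
    and zR: "\<And>i s. zc R i s = (\<lambda>v. 0)"
    and cl: "\<forall>j\<in>{1..n}. \<exists>w. w \<in> Qsf W \<and> z0_place a (cluster G j) w \<and> z0_place ?a' (cluster R j) w"
    using rel unfolding companion_related_def by blast+
  \<comment> \<open>One value \<open>w l\<close> is fixed for the cluster variables of both
    patterns.\<close>
  from bchoice[OF cl] obtain w where wQ: "\<And>l. l \<in> {1..n} \<Longrightarrow> w l \<in> Qsf W"
    and wG: "\<And>l. l \<in> {1..n} \<Longrightarrow> z0_place a (cluster G l) (w l)"
    and wR: "\<And>l. l \<in> {1..n} \<Longrightarrow> z0_place ?a' (cluster R l) (w l)"
    by blast
  \<comment> \<open>Nonzero values permit negative exponents and division by the old cluster
    variable.\<close>
  have nz: "\<And>i. i \<in> {1..n} \<Longrightarrow> a i \<noteq> 0" "\<And>l. l \<in> {1..n} \<Longrightarrow> w l \<noteq> 0"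
    using a wQ Qsf_nonzero by blast+
  have V_simps: "finite V" "y_vars n \<subseteq> V" "finite V'" "y_vars n \<subseteq> V'"
    by (auto simp: V V' finite_y_vars finite_z_vars)
  have carrier: "coefs G k \<in> carrier (Trop V)" "coefs R k \<in> carrier (Trop V')"
    using supp k by (auto simp: Trop_simps V V')
  have z_nonneg: "\<forall>s\<le>deg G k. \<forall>v. zc G k s v \<ge> 0"
  proof (intro allI impI)
    fix s v assume "s \<le> deg G k"
    then show "zc G k s v \<ge> 0"
      using z(1,2)[OF k] z(3)[OF k, of s]
      by (cases "s = 0"; cases "s = d k") (auto simp: degs trop_var_def)
  qed
  have zR': "\<forall>s\<le>deg R k. \<forall>v. zc R k s v \<ge> 0" "zc R k 0 = (\<lambda>v. 0)" "zc R k (deg R k) = (\<lambda>v. 0)"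
    by (simp_all add: zR)
  have zG': "zc G k 0 = (\<lambda>v. 0)" "zc G k (deg G k) = (\<lambda>v. 0)"
    using z k by (simp_all add: degs)
  note coefsG = coefs_mutate_Trop[OF carrier(1) z_nonneg zG']
  note coefsR = coefs_mutate_Trop[OF carrier(2) zR']
  \<comment> \<open>Values under the place: \<open>u\<close> of the generalized yhat,
    \<open>e\<close> of the tropical denominator, \<open>p\<close> of the monomial factor,
    \<open>w'\<close> of the new cluster variable.\<close>
  define u where "u = (\<Prod>i\<in>{1..n}. a i powi coefs G k (YV i)) * (\<Prod>l\<in>{1..n}. w l powi exmat G l k)"
  define e where "e = (\<Prod>i\<in>{1..n}. a i powi min 0 (int (d k) * coefs G k (YV i)))"
  define p where "p = (\<Prod>l\<in>{1..n}. w l powi pos_part (- exmat G l k)) ^ d k"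
  define w' where "w' = p * ((1 + u ^ d k) / e) / w k"
  have Q: "u \<in> Qsf W" "e \<in> Qsf W" "p \<in> Qsf W"
    unfolding u_def e_def p_def by (auto intro!: Qsf.mult Qsf_prod Qsf_powi Qsf_power a wQ)
  then have w'Q: "w' \<in> Qsf W"
    unfolding w'_def using wQ[OF k] by (intro Qsf.intros Qsf_power)
  have e_nz: "e \<noteq> 0"
    using Q Qsf_nonzero by blast

  have "z0_place a (yhat (trop_emb V) n G k) u"
    unfolding yhat_def u_def
    by (intro G.mult G.prod G.powi wG nz z0_place_trop_emb V_simps supp k)
  \<comment> \<open>The end coefficients are 1; each inner one is a z-variable, of value 0.\<close>
  moreover have "z0_place a (trop_emb V (zc G k s)) (if s = 0 \<or> s = d k then 1 else 0)"
    if "s \<le> d k" for s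
  proof (cases "s = 0 \<or> s = d k")
    case True
    then have "zc G k s = (\<lambda>v. 0)" using z k by auto
    then show ?thesis using True by (simp add: trop_emb_def G.one)
  next
    case False
    with that z(3)[OF k, of s] obtain s' where "0 < s'" "s' < d k" "zc G k s = trop_var (ZV k s')"
      by auto
    then have "trop_emb V (zc G k s) = Var (ZV k s')"
      using k V_simps by (subst \<open>zc G k s = _\<close>, intro trop_emb_trop_var) (auto simp: V z_vars_def)
    then show ?thesis using False z0_place_Var(3) by simp
  qed
  ultimately have "z0_place a (Z_field (trop_emb V) G k (yhat (trop_emb V) n G k))
      (\<Sum>s\<le>d k. (if s = 0 \<or> s = d k then 1 else 0) * u ^ s)"
    unfolding Z_field_def degs by (intro G.sum G.mult G.power) auto
  also have "(\<Sum>s\<le>d k. (if s = 0 \<or> s = d k then 1 else 0) * u ^ s) = (\<Sum>s\<in>{0, d k}. u ^ s)"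
    by (rule sum.mono_neutral_cong_right) auto
  \<comment> \<open>Since \<open>d k\<close> is at least 1, the indices 0 and \<open>d k\<close> are
    distinct.\<close>
  also have "\<dots> = 1 + u ^ d k"
    using d[OF k] by auto
  finally have ZG: "z0_place a (Z_field (trop_emb V) G k (yhat (trop_emb V) n G k)) (1 + u ^ d k)" .
  have "z0_place a (trop_emb V (Z_semifield (Trop V) G k (coefs G k))) e"
    unfolding Z_semifield_Trop[OF z_nonneg zG'] e_def degs
    by (intro z0_place_trop_emb V_simps nz) (simp_all add: supp(1)[OF k])
  with ZG have w'G: "z0_place a (cluster ?G' k) w'"
    using nz(2) e_nz wG k
    by (simp add: mutate_def Let_def w'_def p_def degs)
      (intro G.divide G.mult G.power G.prod G.powi wG nz k; simp)

  \<comment> \<open>The clause \<open>c\<close> at index \<open>k\<close> trades the power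
    \<open>d i\<close> inside \<open>?a'\<close> for the power \<open>d k\<close> outside, so the
    companion's yhat has value \<open>u ^ d k\<close>.\<close>
  have "(\<Prod>i\<in>{1..n}. ?a' i powi coefs R k (YV i)) = (\<Prod>i\<in>{1..n}. a i powi coefs G k (YV i)) ^ d k"
    unfolding prod_power_distrib
  proof (intro prod.cong refl)
    fix i assume i: "i \<in> {1..n}"
    have "?a' i powi coefs R k (YV i) = a i powi (int (d i) * coefs R k (YV i))"
      by (simp add: power_int_mult)
    also have "\<dots> = (a i powi coefs G k (YV i)) ^ d k"
      by (simp add: c[OF i k, symmetric] power_int_mult mult.commute[of "int (d k)"])
    finally show "?a' i powi coefs R k (YV i) = (a i powi coefs G k (YV i)) ^ d k" .
  qed
  moreover have "(\<Prod>l\<in>{1..n}. w l powi exmat R l k) = (\<Prod>l\<in>{1..n}. w l powi exmat G l k) ^ d k"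
    unfolding prod_power_distrib using k by (intro prod.cong) (simp_all add: B power_int_mult)
  ultimately have u: "u ^ d k =
      (\<Prod>i\<in>{1..n}. ?a' i powi coefs R k (YV i)) * (\<Prod>l\<in>{1..n}. w l powi exmat R l k)"
    by (simp add: u_def power_mult_distrib)
  \<comment> \<open>By \<open>c\<close>, \<open>d k\<close> times the generalized exponent is
    \<open>d i\<close> times the companion's, and the nonnegative factor \<open>d i\<close> leaves
    the minimum.\<close>
  have e: "e = (\<Prod>i\<in>{1..n}. ?a' i powi min 0 (coefs R k (YV i)))"
    unfolding e_def
  proof (intro prod.cong refl)
    fix i assume i: "i \<in> {1..n}"
    have "min 0 (int (d i) * coefs R k (YV i)) = int (d i) * min 0 (coefs R k (YV i))"
      by (auto simp: min_def mult_le_0_iff zero_le_mult_iff)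
    then show "a i powi min 0 (int (d k) * coefs G k (YV i)) = ?a' i powi min 0 (coefs R k (YV i))"
      by (simp add: c[OF i k] power_int_mult)
  qed
  \<comment> \<open>The outer exponent \<open>d k\<close> moves into the positive part, where it
    turns B into BD.\<close>
  have p: "p = (\<Prod>l\<in>{1..n}. w l powi pos_part (- exmat R l k))"
    unfolding p_def prod_power_distrib
    using k pos_part_mult[of "- exmat G _ k" "d k"]
    by (intro prod.cong) (simp_all add: B power_int_mult)
  have yhatR: "z0_place ?a' (yhat (trop_emb V') n R k) (u ^ d k)"
    unfolding yhat_def u
    by (intro R.mult R.prod R.powi wR z0_place_trop_emb V_simps supp k) (simp_all add: nz)
  \<comment> \<open>The companion's 1 + u, taken at its own yhat, gives the same value as
    \<open>ZG\<close>.\<close>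
  then have ZR: "z0_place ?a' (Z_field (trop_emb V') R k (yhat (trop_emb V') n R k)) (1 + u ^ d k)"
    by (simp add: Z_field_def degs zR trop_emb_def) (intro R.add R.one)
  have "z0_place ?a' (trop_emb V' (Z_semifield (Trop V') R k (coefs R k))) e"
    unfolding Z_semifield_Trop[OF zR'] e degs
    using z0_place_trop_emb[of V' n "\<lambda>v. min 0 (coefs R k v)" ?a'] V_simps nz supp k by simp
  with ZR have w'R: "z0_place ?a' (cluster ?R' k) w'"
    using nz(2) e_nz wR k
    by (simp add: mutate_def Let_def w'_def p degs)
      (intro R.divide R.mult R.prod R.powi wR nz k; simp)

  \<comment> \<open>Scaling the generalized rule by \<open>d j\<close> and the companion rule by
    \<open>d i\<close> matches them term by term, as \<open>d j\<close> and \<open>d i\<close> leave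
    the positive part and the minimum.\<close>
  have coefs': "int (d j) * coefs ?G' j (YV i) = int (d i) * coefs ?R' j (YV i)"
    if "i \<in> {1..n}" "j \<in> {1..n}" for i j
  proof -
    let ?b = "exmat G k j" and ?y = "coefs R k (YV i)"
    have "min 0 (int (d i) * ?y) = int (d i) * min 0 ?y"
      by (auto simp: min_def mult_le_0_iff zero_le_mult_iff)
    then show ?thesis
      using c[OF that] c[OF that(1) k] k that pos_part_mult[of ?b "d j"]
      by (auto simp: coefsG coefsR degs B algebra_simps)
  qed
  \<comment> \<open>The factor \<open>d k\<close> of the generalized rule is the column factor of BD
    at \<open>k\<close>; the common \<open>d j\<close> comes out of every term.\<close>
  have exmat': "exmat ?R' i j = exmat ?G' i j * int (d j)" if "i \<in> {1..n}" "j \<in> {1..n}" for i j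
    using that k pos_part_mult[of "exmat G i k" "d k"] pos_part_mult[of "- exmat G k j" "d j"]
    by (auto simp: mutate_def Let_def degs B algebra_simps)
  \<comment> \<open>Reversal sends s to \<open>d k - s\<close>, again strictly inside the range;
    hence the invariant asks only for some index s'.\<close>
  have z': "\<exists>s'. 0 < s' \<and> s' < d i \<and> zc ?G' i s = trop_var (ZV i s')"
    if "i \<in> {1..n}" "0 < s" "s < d i" for i s
    using z(3)[OF that] z(3)[OF that(1), of "d i - s"] that
    by (auto simp: mutate_def Let_def degs)
  show ?thesis
    unfolding companion_related_def
  proof (intro conjI)
    show "\<forall>j\<in>{1..n}. \<exists>w\<in>Qsf W. z0_place a (cluster ?G' j) w \<and> z0_place ?a' (cluster ?R' j) w"
    proof
      fix j assume "j \<in> {1..n}"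
      then show "\<exists>w\<in>Qsf W. z0_place a (cluster ?G' j) w \<and> z0_place ?a' (cluster ?R' j) w"
        using w'Q w'G w'R wQ wG wR
        by (cases "j = k") (blast, intro bexI[of _ "w j"], auto simp: mutate_def Let_def)
    qed
    show "\<forall>j\<in>{1..n}. \<forall>v. v \<notin> y_vars n \<longrightarrow> coefs ?G' j v = 0 \<and> coefs ?R' j v = 0"
      using supp k by (auto simp: coefsG coefsR)
    show "\<forall>j\<in>{1..n}. \<forall>i\<in>{1..n}. int (d j) * coefs ?G' j (YV i) = int (d i) * coefs ?R' j (YV i)"
      using coefs' by blast
    show "\<forall>i\<in>{1..n}. \<forall>j\<in>{1..n}. exmat ?R' i j = exmat ?G' i j * int (d j)"
      using exmat' by blast
    show "\<forall>k'\<in>{1..n}. zc ?G' k' 0 = (\<lambda>v. 0) \<and> zc ?G' k' (d k') = (\<lambda>v. 0) \<and>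
      (\<forall>s. 0 < s \<and> s < d k' \<longrightarrow> (\<exists>s'. 0 < s' \<and> s' < d k' \<and> zc ?G' k' s = trop_var (ZV k' s')))"
      using z' z(1,2) by (auto simp: mutate_def Let_def degs)
  qed (simp_all add: mutate_def Let_def degs zR)
qed

text \<open>Induction along the path from the root. Keeping \<open>a\<close> and \<open>W\<close>
  general lets both y and yhat be inserted later.\<close>

lemma X_function_companion:
  fixes B :: "nat \<Rightarrow> nat \<Rightarrow> int"
  assumes "\<And>i. i \<in> {1..n} \<Longrightarrow> d i \<ge> 1" "\<And>i. i \<in> {1..n} \<Longrightarrow> a i \<in> Qsf W"
    and "set t \<subseteq> {1..n}" "j \<in> {1..n}"
  shows "\<exists>w\<in>Qsf W. z0_place a (X_function n B d t j) w \<and>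
    z0_place (\<lambda>i. a i ^ d i) (X_function n (\<lambda>i j. B i j * int (d j)) (\<lambda>i. 1) t j) w"
proof -
  define V where "V = y_vars n \<union> z_vars n d"
  define V' where "V' = y_vars n \<union> z_vars n (\<lambda>i. 1)"
  \<comment> \<open>No s satisfies 0 < s < 1, so an ordinary pattern has no z-variables.\<close>
  have V': "V' = y_vars n"
    by (auto simp: V'_def z_vars_def)
  have "companion_related n d a W (seed_at (Trop V) (trop_emb V) n (initial_seed B d) t)
    (seed_at (Trop V') (trop_emb V') n (initial_seed (\<lambda>i j. B i j * int (d j)) (\<lambda>i. 1)) t)"
    using assms(3)
  proof (induction t)
    case Nil
    then show ?case using companion_related_initial assms(1) by simp
  next
    case (Cons k t)
    then show ?case
      using companion_related_mutate[OF _ _ assms(1,2) V_def V'] by simp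
  qed
  then show ?thesis
    using assms(4) unfolding companion_related_def X_function_def Let_def V_def V'_def by blast
qed

theorem proposition4p6:
  fixes P :: "('p, 'm) semifield_scheme" and \<iota> :: "'p \<Rightarrow> 'f::field" and F :: "'f set"
    and n :: nat and S :: "('f, 'p) seed" and t :: "nat list" and j :: nat
  assumes "generalized_seed P \<iota> F n S"
    and "t \<in> tree n" and "j \<in> {1..n}"
  shows
    "(let B = exmat S; d = deg S;
          Ft = F_poly_of_seed n S t j;
          RFt = F_poly_of_seed n (right_companion P S) t j;
          y = (\<lambda>i. Var (YV i));
          yh = yhat_var n B
      in eval_at_z0 Ft y \<in> Qsf (y_vars n)
       \<and> eval_at_z0 RFt (\<lambda>i. y i ^ d i) \<in> Qsf (y_vars n)
       \<and> eval_at_z0 Ft y = eval_at_z0 RFt (\<lambda>i. y i ^ d i)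
       \<and> eval_at_z0 Ft yh \<in> Qsf (x_vars n \<union> y_vars n)
       \<and> eval_at_z0 RFt (\<lambda>i. yh i ^ d i) \<in> Qsf (x_vars n \<union> y_vars n)
       \<and> eval_at_z0 Ft yh = eval_at_z0 RFt (\<lambda>i. yh i ^ d i))"
proof -
  let ?Ft = "F_poly_of_seed n S t j" and ?RFt = "F_poly_of_seed n (right_companion P S) t j"
  \<comment> \<open>Both equalities are instances of this claim: the common value in
    \<open>W\<close> is at once the value of either side.\<close>
  have main: "eval_at_z0 ?Ft a \<in> Qsf W \<and> eval_at_z0 ?RFt (\<lambda>i. a i ^ deg S i) \<in> Qsf W \<and>
      eval_at_z0 ?Ft a = eval_at_z0 ?RFt (\<lambda>i. a i ^ deg S i)"
    if "\<And>i. i \<in> {1..n} \<Longrightarrow> a i \<in> Qsf W" for a W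
  proof -
    have "set t \<subseteq> {1..n}"
      using assms(2) by (simp add: tree_def)
    from X_function_companion[where d = "deg S" and a = a and W = W and B = "exmat S",
        OF generalized_seed.deg_pos[OF assms(1)] that this assms(3)]
    show ?thesis
      by (auto simp: F_poly_of_seed_def right_companion_def dest!: eval_at_z0_F_polynomial)
  qed
  have yh: "yhat_var n (exmat S) i \<in> Qsf (x_vars n \<union> y_vars n)" if "i \<in> {1..n}" for i
    unfolding yhat_var_def using that
    by (auto intro!: Qsf.mult Qsf_prod Qsf_powi Qsf.var simp: x_vars_def y_vars_def)
  have y: "Var (YV i) \<in> Qsf (y_vars n)" if "i \<in> {1..n}" for i
    using that by (auto intro!: Qsf.var simp: y_vars_def)
  from main[OF y] main[OF yh] show ?thesis
    by (simp add: Let_def)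
qed

end
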